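(* Let $n\in\mathbb N$ be divisible by $3$. Suppose $G$ is an $n$-vertex digraph such that for all distinct $x,y\in V(G)$ with $xy\notin E(G)$ we have $d^+_G(x)+d^-_G(y)\ge 4n/3-1$. Then $G$ contains a $T_3$-factor.
   Context: Digraphs have no loops and at most one edge in each direction between any pair of vertices; $xy$ denotes the edge from $x$ to $y$. $d^+_G(x)$ and $d^-_G(x)$ are the out-degree and in-degree of $x$. $T_r$ denotes the transitive tournament on $r$ vertices. A $T_3$-factor is a collection of vertex-disjoint copies of $T_3$ in $G$ covering all vertices. *)

theory Defs
  imports Complex_Main "Graph_Theory.Graph_Theory"
begin

definition transitive_tournament :: "nat \<Rightarrow> (nat, nat \<times> nat) pre_digraph" where
  "transitive_tournament r =
     \<lparr>verts = {..<r}, arcs = {(i, j). i < j \<and> j < r}, tail = fst, head = snd\<rparr>"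

lemma transitive_tournament_properties:
  shows "digraph (transitive_tournament r)"
    and "card (verts (transitive_tournament r)) = r"
    and "trans (arcs_ends (transitive_tournament r))"
    and "\<lbrakk>i \<in> verts (transitive_tournament r); j \<in> verts (transitive_tournament r); i \<noteq> j\<rbrakk> \<Longrightarrow>
      (i, j) \<in> arcs_ends (transitive_tournament r) \<longleftrightarrow>
      (j, i) \<notin> arcs_ends (transitive_tournament r)"
proof -
  have ends: "arcs_ends (transitive_tournament r) = {(i, j). i < j \<and> j < r}"
    by (simp add: transitive_tournament_def arcs_ends_def arc_to_ends_def)
  have "finite {(i, j). i < j \<and> j < r}"
    by (rule finite_subset[of _ "{..<r} \<times> {..<r}"]) auto
  then show "digraph (transitive_tournament r)"
    by unfold_locales (auto simp: transitive_tournament_def arc_to_ends_def)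
  show "card (verts (transitive_tournament r)) = r"
    by (simp add: transitive_tournament_def)
  show "trans (arcs_ends (transitive_tournament r))"
    unfolding ends by (auto intro: transI)
  show "(i, j) \<in> arcs_ends (transitive_tournament r) \<longleftrightarrow>
      (j, i) \<notin> arcs_ends (transitive_tournament r)"
    if "i \<in> verts (transitive_tournament r)" "j \<in> verts (transitive_tournament r)" "i \<noteq> j"
    using that unfolding ends by (auto simp: transitive_tournament_def)
qed

text \<open>A copy of \<open>T\<close> in \<open>G\<close> is a subgraph, not necessarily induced, that is isomorphic to \<open>T\<close>.\<close>

definition is_factor ::
  "('c, 'd) pre_digraph \<Rightarrow> ('a, 'b) pre_digraph \<Rightarrow> ('a, 'b) pre_digraph set \<Rightarrow> bool" where
  "is_factor T G F \<longleftrightarrow>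
     (\<forall>H\<in>F. subgraph H G \<and> digraph_iso T H) \<and>
     pairwise (\<lambda>H K. verts H \<inter> verts K = {}) F \<and>
     (\<Union>H\<in>F. verts H) = verts G"

end

theory Submission
  imports Defs "HOL-Library.Disjoint_Sets"
begin

text \<open>
  Let \<open>A\<close> be a largest acyclic set of arcs of \<open>G\<close>, and forget the orientations of \<open>A\<close>. Replacing
  the arcs of \<open>A\<close> at a vertex \<open>x\<close> by all arcs of \<open>G\<close> leaving (or all arcs entering) \<open>x\<close> keeps
  \<open>A\<close> acyclic, so the degree of \<open>x\<close> in \<open>A\<close> is at least its out-degree and its in-degree in \<open>G\<close>;
  and vertices joined in both directions in \<open>G\<close> are adjacent in \<open>A\<close>. Hence with \<open>n = 3 k\<close> the
  undirected graph \<open>A\<close> satisfies \<open>d(x) + d(y) \<ge> 4 k - 1\<close> for all nonadjacent \<open>x \<noteq> y\<close>, and every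
  triangle of \<open>A\<close> is transitive. This reduces the theorem to an Ore-type version of the
  Corradi-Hajnal theorem.

  For the latter, an edge-maximal counterexample is covered by \<open>k - 1\<close> triangles and a path
  \<open>x z y\<close>. By the degree condition some triangle \<open>a b c\<close> receives at least five edges from
  \<open>{x, y}\<close>, say all but possibly \<open>y c\<close>. If \<open>z\<close> is adjacent to one of \<open>a, b, c\<close>, these six vertices
  form two triangles. Otherwise, adding the degree conditions for \<open>z, c\<close> (twice) and \<open>x, y\<close> (once)
  gives a further triangle \<open>T\<close> for which the numbers of edges to \<open>z, c, x, y\<close>, weighted by
  \<open>2, 2, 1, 1\<close>, sum to at least 13, and then the nine vertices form three triangles.
\<close>

section \<open>Triangle factors and counting neighbours along them\<close>

definition triangle_factor :: "('a \<times> 'a) set \<Rightarrow> 'a set \<Rightarrow> 'a set set \<Rightarrow> bool" where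
  "triangle_factor E V P \<longleftrightarrow>
     partition_on V P \<and> (\<forall>T\<in>P. card T = 3 \<and> (\<forall>x\<in>T. \<forall>y\<in>T. x \<noteq> y \<longrightarrow> (x, y) \<in> E))"

lemma triangle_factor_insert:
  assumes "triangle_factor E U Q" "sym E" "(x, y) \<in> E" "(y, z) \<in> E" "(x, z) \<in> E"
    and "distinct [x, y, z]" "{x, y, z} \<inter> U = {}"
  shows "triangle_factor E ({x, y, z} \<union> U) (insert {x, y, z} Q)"
proof -
  have "partition_on ({x, y, z} \<union> U) (insert {x, y, z} Q)"
    using assms(1,7) unfolding triangle_factor_def partition_on_def
    by (auto simp: disjoint_def)
  then show ?thesis
    using assms symD[OF assms(2)] unfolding triangle_factor_def by auto
qed

lemma triangle_factor_remove:
  assumes "triangle_factor E V P" "T \<in> P"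
  shows "triangle_factor E (V - T) (P - {T})"
proof -
  have "\<Union>(P - {T}) = V - T" "disjoint (P - {T})"
    using assms unfolding triangle_factor_def partition_on_def disjoint_def by auto
  then show ?thesis
    using assms(1) unfolding triangle_factor_def partition_on_def by auto
qed

text \<open>Used with \<open>N\<close> a neighbourhood and \<open>W\<close> the vertices outside the
  tiling: a degree splits into a part inside \<open>W\<close> and one part per triangle, so degree
  bounds can be averaged over the triangles.\<close>

lemma card_eq_sum_triangle_factor:
  assumes "triangle_factor E (V - W) Q" "finite V" "W \<subseteq> V"
  shows "card (N \<inter> V) = card (N \<inter> W) + (\<Sum>T\<in>Q. card (N \<inter> T))"
proof -
  have Q: "\<Union>Q = V - W" "disjoint Q"
    using assms(1) unfolding triangle_factor_def partition_on_def by auto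
  have "finite Q" "\<And>T. T \<in> Q \<Longrightarrow> finite T"
    using Q(1) assms(2) by (auto intro: finite_UnionD finite_subset[of _ V])
  then have "card (\<Union>T\<in>Q. N \<inter> T) = (\<Sum>T\<in>Q. card (N \<inter> T))"
    using Q(2) by (intro card_UN_disjoint) (auto simp: disjoint_def)
  moreover have "N \<inter> V = N \<inter> W \<union> (\<Union>T\<in>Q. N \<inter> T)" "N \<inter> W \<inter> (\<Union>T\<in>Q. N \<inter> T) = {}"
    using Q(1) assms(3) by auto
  moreover have "finite (N \<inter> W)" "finite (\<Union>T\<in>Q. N \<inter> T)"
    using \<open>finite Q\<close> \<open>\<And>T. T \<in> Q \<Longrightarrow> finite T\<close> assms(2,3) by (auto intro: finite_subset)
  ultimately show ?thesis
    by (simp add: card_Un_disjoint)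
qed

lemma card_triangle_factor:
  assumes "triangle_factor E V Q" "finite V"
  shows "card V = 3 * card Q"
proof -
  have "\<forall>T\<in>Q. card T = 3"
    using assms(1) by (simp add: triangle_factor_def)
  then show ?thesis
    using card_eq_sum_triangle_factor[of E V "{}" Q UNIV] assms by simp
qed

section \<open>The Ore-type Corradi-Hajnal theorem for undirected graphs\<close>

lemma card_Int_triple:
  assumes "distinct [p, q, r]"
  shows "card (N \<inter> {p, q, r}) = of_bool (p \<in> N) + of_bool (q \<in> N) + of_bool (r \<in> N)"
  using assms by (simp add: Int_insert_right)

text \<open>
  \<open>Z\<close>, \<open>C\<close>, \<open>X\<close>, \<open>Y\<close> are the neighbourhoods of \<open>z, c, x, y\<close>. Each alternative in the conclusion
  distributes \<open>z\<close> and two of \<open>c, x, y\<close> over the vertex \<open>v\<close> and the edge \<open>u w\<close> of the triangle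
  \<open>p q r\<close>; the remaining vertex of \<open>c, x, y\<close> forms a triangle with \<open>a\<close> and \<open>b\<close>.
\<close>

lemma triple_exchange:
  fixes X Y Z C :: "'a \<Rightarrow> bool"
  assumes "13 \<le> 2 * (of_bool (Z p) + of_bool (Z q) + of_bool (Z r))
    + 2 * (of_bool (C p) + of_bool (C q) + of_bool (C r))
    + (of_bool (X p) + of_bool (X q) + of_bool (X r))
    + (of_bool (Y p) + of_bool (Y q) + of_bool (Y r) :: nat)"
  obtains v u w where "(v, u, w) \<in> {(p, q, r), (q, p, r), (r, p, q)}"
    "Z v \<and> X v \<and> C u \<and> C w \<or> C v \<and> X v \<and> Z u \<and> Z w \<or> Y v \<and> Z v \<and> C u \<and> C w
     \<or> Z v \<and> X v \<and> Y u \<and> Y w \<or> Z v \<and> Y v \<and> X u \<and> X w"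
proof -
  define G where "G v u w \<longleftrightarrow>
    Z v \<and> X v \<and> C u \<and> C w \<or> C v \<and> X v \<and> Z u \<and> Z w \<or> Y v \<and> Z v \<and> C u \<and> C w
     \<or> Z v \<and> X v \<and> Y u \<and> Y w \<or> Z v \<and> Y v \<and> X u \<and> X w" for v u w
  have "(of_bool (X p) + of_bool (X q) + of_bool (X r))
    + (of_bool (Y p) + of_bool (Y q) + of_bool (Y r)) \<le> (6::nat)"
    by (simp add: of_bool_def)
  \<comment> \<open>\<open>X\<close> and \<open>Y\<close> contribute at most 6, so at least four of
    the six edges from \<open>z\<close> and \<open>c\<close> are present. This prunes the first case
    split before \<open>X\<close> and \<open>Y\<close> are split.\<close>
  then have "7 \<le> 2 * (of_bool (Z p) + of_bool (Z q) + of_bool (Z r))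
    + 2 * (of_bool (C p) + of_bool (C q) + of_bool (C r) :: nat)"
    using assms by linarith
  then have "G p q r \<or> G q p r \<or> G r p q"
    using assms unfolding G_def
    apply (cases "Z p"; cases "Z q"; cases "Z r"; cases "C p"; cases "C q"; cases "C r"; simp)
    apply (cases "X p"; cases "X q"; cases "X r"; simp; cases "Y p"; cases "Y q"; cases "Y r"; simp)+
    done
  then show ?thesis
    using that unfolding G_def by blast
qed

text \<open>\<open>E\<close> is not confined to \<open>V\<close>, so neighbourhoods are cut down to
  \<open>V\<close>. Writing \<open>+ 1\<close> on the right avoids truncated subtraction in 4 k -
  1.\<close>

locale ore_graph =
  fixes E :: "('a \<times> 'a) set" and V :: "'a set" and k :: nat
  assumes finite_V: "finite V"
    and card_V: "card V = 3 * k"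
    and sym_E: "sym E"
    and irrefl_E: "irrefl E"
    and ore: "\<lbrakk>u \<in> V; v \<in> V; u \<noteq> v; (u, v) \<notin> E\<rbrakk> \<Longrightarrow>
      4 * k \<le> card (E `` {u} \<inter> V) + card (E `` {v} \<inter> V) + 1"
begin

lemma not_loop: "(v, v) \<notin> E"
  using irrefl_E by (simp add: irrefl_def)

lemma triangle_factor_of_near_tiling:
  assumes dist: "distinct [x, y, z, a, b, c]" and sub: "{x, y, z, a, b, c} \<subseteq> V"
    and edges: "(x, z) \<in> E" "(y, z) \<in> E" "(x, a) \<in> E" "(x, b) \<in> E" "(x, c) \<in> E"
      "(y, a) \<in> E" "(y, b) \<in> E" "(a, b) \<in> E" "(a, c) \<in> E" "(b, c) \<in> E"
    and "(x, y) \<notin> E"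
    and Q: "triangle_factor E (V - {x, y, z, a, b, c}) Q"
  shows "\<exists>P. triangle_factor E V P"
proof -
  let ?W = "{x, y, z, a, b, c}"
  note edges' = edges edges[THEN symD[OF sym_E]] and ins = triangle_factor_insert[OF _ sym_E]
  have dist': "distinct [c, b, a, z, y, x]"
    using dist by auto
  have two: "\<exists>P. triangle_factor E V P"
    if "?W = {p, q, r, s, t, u}" "distinct [p, q, r, s, t, u]"
      "(p, q) \<in> E" "(q, r) \<in> E" "(p, r) \<in> E" "(s, t) \<in> E" "(t, u) \<in> E" "(s, u) \<in> E"
    for p q r s t u
  proof -
    have V: "{p, q, r} \<union> ({s, t, u} \<union> (V - ?W)) = V"
      using that(1) sub by blast
    have "triangle_factor E ({s, t, u} \<union> (V - ?W)) (insert {s, t, u} Q)"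
      by (rule ins[OF Q]) (use that in auto)
    then have "triangle_factor E ({p, q, r} \<union> ({s, t, u} \<union> (V - ?W)))
        (insert {p, q, r} (insert {s, t, u} Q))"
      by (rule ins) (use that in auto)
    then show ?thesis unfolding V by blast
  qed
  \<comment> \<open>A neighbour \<open>a\<close> or \<open>b\<close> of \<open>z\<close> closes the
    edge \<open>y z\<close>, and \<open>x\<close> takes the other two; \<open>c\<close> must close
    \<open>x z\<close> instead, because \<open>y c\<close> need not be an edge.\<close>
  consider "(z, a) \<in> E" | "(z, b) \<in> E" | "(z, c) \<in> E"
    | "(z, a) \<notin> E" "(z, b) \<notin> E" "(z, c) \<notin> E" by blast
  then show ?thesis
  proof cases
    case 1
    then show ?thesis using dist dist' edges by - (rule two[of y z a x b c], blast, simp_all)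
  next
    case 2
    then show ?thesis using dist dist' edges by - (rule two[of y z b x a c], blast, simp_all)
  next
    case 3
    then show ?thesis using dist dist' edges by - (rule two[of x z c y a b], blast, simp_all)
  next
    case 4
    define e where "e v T = card (E `` {v} \<inter> T)" for v T
    have deg: "e v V = e v ?W + (\<Sum>T\<in>Q. e v T)" for v
      unfolding e_def using card_eq_sum_triangle_factor[OF Q finite_V sub] .
    have cardQ: "3 * k = 6 + 3 * card Q"
      using card_triangle_factor[OF Q] finite_V sub dist card_mono[OF finite_V sub]
      by (simp add: card_Diff_subset card_V)
    have le_card: "e v ?W \<le> n" if "E `` {v} \<inter> ?W \<subseteq> set xs" "length xs = n" for v xs n
      unfolding e_def using card_mono[OF _ that(1)] card_length[of xs] that(2) by simp
    have non: "(c, z) \<notin> E" "(y, x) \<notin> E"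
      using 4 \<open>(x, y) \<notin> E\<close> sym_E by (auto dest: symD)
    have "e z ?W \<le> 2"
      by (rule le_card[of _ "[x, y]"]) (use 4 not_loop in auto)
    moreover have "e c ?W \<le> 4"
      by (rule le_card[of _ "[x, y, a, b]"]) (use non not_loop in auto)
    moreover have "e x ?W \<le> 4"
      by (rule le_card[of _ "[z, a, b, c]"]) (use \<open>(x, y) \<notin> E\<close> not_loop in auto)
    moreover have "e y ?W \<le> 4"
      by (rule le_card[of _ "[z, a, b, c]"]) (use non not_loop in auto)
    moreover have "4 * k \<le> e z V + e c V + 1" "4 * k \<le> e x V + e y V + 1"
      unfolding e_def using ore 4 \<open>(x, y) \<notin> E\<close> dist sub by auto
    \<comment> \<open>The weighted degree conditions give 12 k - 3, which is 12
      \<open>card Q\<close> + 21 since k = \<open>card Q\<close> + 2. At most 2*2 + 2*4 + 4 + 4 = 20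
      of this falls inside \<open>?W\<close>.\<close>
    ultimately have "12 * card Q + 1 \<le> 2 * (\<Sum>T\<in>Q. e z T) + 2 * (\<Sum>T\<in>Q. e c T)
        + (\<Sum>T\<in>Q. e x T) + (\<Sum>T\<in>Q. e y T)"
      using deg[of x] deg[of y] deg[of z] deg[of c] cardQ by linarith
    also have "\<dots> = (\<Sum>T\<in>Q. 2 * e z T + 2 * e c T + e x T + e y T)"
      by (simp add: sum.distrib sum_distrib_left)
    finally have "\<not> (\<forall>T\<in>Q. 2 * e z T + 2 * e c T + e x T + e y T \<le> 12)"
      using sum_bounded_above[of Q "\<lambda>T. 2 * e z T + 2 * e c T + e x T + e y T" 12] by auto
    then obtain T where T: "T \<in> Q" "13 \<le> 2 * e z T + 2 * e c T + e x T + e y T"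
      by force
    obtain p q r where pqr: "T = {p, q, r}" "distinct [p, q, r]"
      using T(1) Q unfolding triangle_factor_def by (auto simp: card_3_iff)
    obtain v u w where vuw: "(v, u, w) \<in> {(p, q, r), (q, p, r), (r, p, q)}"
      and good: "(z, v) \<in> E \<and> (x, v) \<in> E \<and> (c, u) \<in> E \<and> (c, w) \<in> E
        \<or> (c, v) \<in> E \<and> (x, v) \<in> E \<and> (z, u) \<in> E \<and> (z, w) \<in> E
        \<or> (y, v) \<in> E \<and> (z, v) \<in> E \<and> (c, u) \<in> E \<and> (c, w) \<in> E
        \<or> (z, v) \<in> E \<and> (x, v) \<in> E \<and> (y, u) \<in> E \<and> (y, w) \<in> E
        \<or> (z, v) \<in> E \<and> (y, v) \<in> E \<and> (x, u) \<in> E \<and> (x, w) \<in> E"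
      by (rule triple_exchange[where p = p and q = q and r = r and Z = "\<lambda>v. (z, v) \<in> E"
            and C = "\<lambda>v. (c, v) \<in> E" and X = "\<lambda>v. (x, v) \<in> E" and Y = "\<lambda>v. (y, v) \<in> E"])
        (use T(2) pqr in \<open>simp_all add: e_def card_Int_triple\<close>)
    have T_eq: "T = {v, u, w}" and dist_T: "distinct [v, u, w]"
      using vuw pqr by auto
    have T_disj: "T \<inter> ?W = {}" "T \<subseteq> V"
      using T(1) Q unfolding triangle_factor_def partition_on_def by auto
    have "(u, w) \<in> E"
      using T(1) T_eq dist_T Q unfolding triangle_factor_def by auto
    \<comment> \<open>Here \<open>t\<close> closes the edge \<open>a b\<close>, \<open>v\<close>
      closes \<open>g h\<close>, and \<open>i\<close> closes \<open>u w\<close>. Each alternative of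
      \<open>good\<close> is one assignment of \<open>x, y, z, c\<close> to
      \<open>t, g, h, i\<close>.\<close>
    have three: "\<exists>P. triangle_factor E V P"
      if W: "?W = {a, b, t, g, h, i}" and "distinct [a, b, t, g, h, i]"
        "(a, t) \<in> E" "(b, t) \<in> E" "(g, h) \<in> E" "(g, v) \<in> E" "(h, v) \<in> E"
        "(i, u) \<in> E" "(i, w) \<in> E"
      for t g h i
    proof -
      let ?U = "V - ?W - T"
      have V: "{a, b, t} \<union> ({g, h, v} \<union> ({i, u, w} \<union> ?U)) = V"
        using W sub T_disj(2) T_eq by blast
      have new: "v \<notin> ?W" "u \<notin> ?W" "w \<notin> ?W"
        using T_disj(1) T_eq by auto
      have "triangle_factor E ({i, u, w} \<union> ?U) (insert {i, u, w} (Q - {T}))"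
        by (rule ins[OF triangle_factor_remove[OF Q T(1)]])
          (use that new dist_T T_eq \<open>(u, w) \<in> E\<close> in auto)
      then have "triangle_factor E ({g, h, v} \<union> ({i, u, w} \<union> ?U))
          (insert {g, h, v} (insert {i, u, w} (Q - {T})))"
        by (rule ins) (use that new dist_T T_eq in auto)
      then have "triangle_factor E ({a, b, t} \<union> ({g, h, v} \<union> ({i, u, w} \<union> ?U)))
          (insert {a, b, t} (insert {g, h, v} (insert {i, u, w} (Q - {T}))))"
        by (rule ins) (use that new dist_T T_eq edges in auto)
      then show ?thesis unfolding V by blast
    qed
    show ?thesis
      using good
    proof (elim disjE conjE)
      assume "(z, v) \<in> E" "(x, v) \<in> E" "(c, u) \<in> E" "(c, w) \<in> E"
      then show ?thesis using dist dist' edges' by - (rule three[of y x z c], blast, simp_all)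
    next
      assume "(c, v) \<in> E" "(x, v) \<in> E" "(z, u) \<in> E" "(z, w) \<in> E"
      then show ?thesis using dist dist' edges' by - (rule three[of y x c z], blast, simp_all)
    next
      assume "(y, v) \<in> E" "(z, v) \<in> E" "(c, u) \<in> E" "(c, w) \<in> E"
      then show ?thesis using dist dist' edges' by - (rule three[of x y z c], blast, simp_all)
    next
      assume "(z, v) \<in> E" "(x, v) \<in> E" "(y, u) \<in> E" "(y, w) \<in> E"
      then show ?thesis using dist dist' edges' by - (rule three[of c x z y], blast, simp_all)
    next
      assume "(z, v) \<in> E" "(y, v) \<in> E" "(x, u) \<in> E" "(x, w) \<in> E"
      then show ?thesis using dist dist' edges' by - (rule three[of c y z x], blast, simp_all)
    qed
  qed
qed

lemma triangle_factor_of_path: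
  assumes dist: "distinct [x, y, z]" and sub: "{x, y, z} \<subseteq> V"
    and edges: "(x, z) \<in> E" "(y, z) \<in> E" and "(x, y) \<notin> E"
    and Q: "triangle_factor E (V - {x, y, z}) Q"
  shows "\<exists>P. triangle_factor E V P"
proof -
  define e where "e v T = card (E `` {v} \<inter> T)" for v T
  have deg: "e v V = e v {x, y, z} + (\<Sum>T\<in>Q. e v T)" for v
    unfolding e_def using card_eq_sum_triangle_factor[OF Q finite_V sub] .
  have cardQ: "3 * k = 3 + 3 * card Q"
    using card_triangle_factor[OF Q] finite_V sub dist card_mono[OF finite_V sub]
    by (simp add: card_Diff_subset card_V)
  have "(y, x) \<notin> E"
    using \<open>(x, y) \<notin> E\<close> sym_E by (auto dest: symD)
  then have "E `` {x} \<inter> {x, y, z} \<subseteq> {z}" "E `` {y} \<inter> {x, y, z} \<subseteq> {z}"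
    using \<open>(x, y) \<notin> E\<close> not_loop by auto
  then have "e x {x, y, z} \<le> 1" "e y {x, y, z} \<le> 1"
    unfolding e_def using card_mono[of "{z}"] by auto
  moreover have "4 * k \<le> e x V + e y V + 1"
    unfolding e_def using ore dist sub \<open>(x, y) \<notin> E\<close> by simp
  \<comment> \<open>At most 2 of the at least 4 k - 1 edge ends at \<open>x\<close> and
    \<open>y\<close> are used inside the path, and k = \<open>card Q\<close> + 1.\<close>
  ultimately have "4 * card Q + 1 \<le> (\<Sum>T\<in>Q. e x T + e y T)"
    using deg[of x] deg[of y] cardQ by (simp add: sum.distrib)
  then have "\<not> (\<forall>T\<in>Q. e x T + e y T \<le> 4)"
    using sum_bounded_above[of Q "\<lambda>T. e x T + e y T" 4] by auto
  then obtain T where T: "T \<in> Q" "5 \<le> e x T + e y T"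
    by force
  obtain p q r where pqr: "T = {p, q, r}" "distinct [p, q, r]"
    using T(1) Q unfolding triangle_factor_def by (auto simp: card_3_iff)
  have T_edges: "(p, q) \<in> E" "(p, r) \<in> E" "(q, r) \<in> E" "(q, p) \<in> E" "(r, p) \<in> E" "(r, q) \<in> E"
    using T(1) pqr Q unfolding triangle_factor_def by auto
  have T_disj: "T \<inter> {x, y, z} = {}" "T \<subseteq> V"
    using T(1) Q unfolding triangle_factor_def partition_on_def by auto
  \<comment> \<open>\<open>u\<close> is the end of the path joined to all of \<open>T\<close>, and
    \<open>c\<close> is the only vertex of \<open>T\<close> that \<open>v\<close> may miss.\<close>
  have swap: "\<exists>P. triangle_factor E V P"
    if uv: "{u, v} = {x, y}" "u \<noteq> v" and T_eq: "T = {a, b, c}" "distinct [a, b, c]"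
      and "(a, b) \<in> E" "(a, c) \<in> E" "(b, c) \<in> E"
      and "(u, a) \<in> E" "(u, b) \<in> E" "(u, c) \<in> E" "(v, a) \<in> E" "(v, b) \<in> E"
    for u v a b c
  proof (rule triangle_factor_of_near_tiling[of u v z a b c])
    have "V - {x, y, z} - T = V - {u, v, z, a, b, c}"
      using uv T_eq by blast
    then show "triangle_factor E (V - {u, v, z, a, b, c}) (Q - {T})"
      using triangle_factor_remove[OF Q T(1)] by simp
    have "u = x \<and> v = y \<or> u = y \<and> v = x"
      using uv by (auto simp: doubleton_eq_iff)
    then show "distinct [u, v, z, a, b, c]" "{u, v, z, a, b, c} \<subseteq> V"
      "(u, z) \<in> E" "(v, z) \<in> E" "(u, v) \<notin> E"
      using dist sub edges \<open>(x, y) \<notin> E\<close> \<open>(y, x) \<notin> E\<close> T_eq T_disj by auto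
  qed (fact that)+
  have half: "\<exists>P. triangle_factor E V P"
    if uv: "{u, v} = {x, y}" "u \<noteq> v" and "e u T = 3" "2 \<le> e v T" for u v
  proof -
    have u: "(u, p) \<in> E" "(u, q) \<in> E" "(u, r) \<in> E"
      using \<open>e u T = 3\<close> unfolding e_def pqr(1) card_Int_triple[OF pqr(2)]
      by (auto simp: of_bool_def split: if_splits)
    consider "(v, p) \<in> E" "(v, q) \<in> E" | "(v, p) \<in> E" "(v, r) \<in> E"
      | "(v, q) \<in> E" "(v, r) \<in> E"
      using \<open>2 \<le> e v T\<close> unfolding e_def pqr(1) card_Int_triple[OF pqr(2)]
      by (auto simp: of_bool_def split: if_splits)
    then show ?thesis
    proof cases
      case 1
      then show ?thesis using pqr T_edges u by (intro swap[OF uv, of p q r]) auto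
    next
      case 2
      then show ?thesis using pqr T_edges u by (intro swap[OF uv, of p r q]) auto
    next
      case 3
      then show ?thesis using pqr T_edges u by (intro swap[OF uv, of q r p]) auto
    qed
  qed
  have "e x T \<le> 3" "e y T \<le> 3"
    unfolding e_def pqr(1) card_Int_triple[OF pqr(2)] by (simp_all add: of_bool_def)
  then have "e x T = 3 \<and> 2 \<le> e y T \<or> e y T = 3 \<and> 2 \<le> e x T"
    using T(2) by linarith
  then show ?thesis
    using half[of x y] half[of y x] dist by (auto simp: insert_commute)
qed

end

lemma ex_partition_into_triples:
  assumes "finite V" "card V = 3 * k"
  shows "\<exists>P. partition_on V P \<and> (\<forall>T\<in>P. card T = 3)"
  using assms
proof (induction k arbitrary: V)
  case 0
  then show ?case by (auto simp: partition_on_empty)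
next
  case (Suc k)
  then obtain T where T: "T \<subseteq> V" "card T = 3" "finite T"
    using obtain_subset_with_card_n[of 3 V] by auto
  then have "card (V - T) = 3 * k"
    using Suc.prems by (simp add: card_Diff_subset)
  then obtain P where P: "partition_on (V - T) P" "\<forall>T\<in>P. card T = 3"
    using Suc.IH[of "V - T"] Suc.prems by auto
  have "disjnt T (\<Union>P)" "T \<noteq> {}"
    using P(1) T by (auto simp: partition_on_def disjnt_def)
  then have "partition_on V (insert T P)"
    using partition_on_insert P(1) T(1) by blast
  then show ?case
    using P(2) T(2) by blast
qed

text \<open>Induction on the number of missing ordered pairs replaces the edge-maximal
  counterexample: inserting a nonedge keeps the Ore condition, and a factor of the larger graph
  either avoids the new edge or has one triangle through it, which becomes the path for
  \<open>triangle_factor_of_path\<close>.\<close>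

lemma ore_triangle_factor:
  assumes "ore_graph E V k"
  shows "\<exists>P. triangle_factor E V P"
  using assms
proof (induction "card (V \<times> V - E)" arbitrary: E rule: less_induct)
  case less
  interpret ore_graph E V k by (rule less.prems)
  show ?case
  proof (cases "\<forall>x\<in>V. \<forall>y\<in>V. x \<noteq> y \<longrightarrow> (x, y) \<in> E")
    case True
    obtain P where "partition_on V P" "\<forall>T\<in>P. card T = 3"
      using ex_partition_into_triples[OF finite_V card_V] by blast
    moreover from this have "T \<subseteq> V" if "T \<in> P" for T
      using that by (auto simp: partition_on_def)
    ultimately have "triangle_factor E V P"
      using True unfolding triangle_factor_def by blast
    then show ?thesis by blast
  next
    case False
    then obtain x y where xy: "x \<in> V" "y \<in> V" "x \<noteq> y" "(x, y) \<notin> E"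
      by blast
    define E' where "E' = {(x, y), (y, x)} \<union> E"
    have "card (E `` {u} \<inter> V) \<le> card (E' `` {u} \<inter> V)" for u
      using finite_V by (intro card_mono) (auto simp: E'_def)
    then have "4 * k \<le> card (E' `` {u} \<inter> V) + card (E' `` {v} \<inter> V) + 1"
      if "u \<in> V" "v \<in> V" "u \<noteq> v" "(u, v) \<notin> E'" for u v
      using ore[of u v] that unfolding E'_def
      by (meson UnI2 add_le_mono le_trans order_refl)
    then have "ore_graph E' V k"
      using finite_V card_V sym_E irrefl_E xy(3)
      by unfold_locales (auto simp: E'_def sym_def irrefl_def)
    moreover have "card (V \<times> V - E') < card (V \<times> V - E)"
      using xy finite_V by (intro psubset_card_mono) (auto simp: E'_def)
    ultimately obtain P where P: "triangle_factor E' V P"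
      using less.hyps by blast
    show ?thesis
    proof (cases "\<exists>T\<in>P. {x, y} \<subseteq> T")
      case False
      then have "triangle_factor E V P"
        using P unfolding triangle_factor_def E'_def by blast
      then show ?thesis by blast
    next
      case True
      then obtain T where T: "T \<in> P" "x \<in> T" "y \<in> T" by blast
      have "card T = 3" and T_edges: "\<And>u v. \<lbrakk>u \<in> T; v \<in> T; u \<noteq> v\<rbrakk> \<Longrightarrow> (u, v) \<in> E'"
        using P T(1) unfolding triangle_factor_def by blast+
      then have "card (T - {x, y}) = 1"
        using T xy(3) by (simp add: card_Diff_subset)
      then obtain z where "T - {x, y} = {z}"
        by (rule card_1_singletonE)
      then have T_eq: "T = {x, y, z}" and z: "z \<noteq> x" "z \<noteq> y"
        using T by auto
      have "triangle_factor E' (V - T) (P - {T})"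
        by (rule triangle_factor_remove[OF P T(1)])
      \<comment> \<open>The new edge contains \<open>x\<close>, so the remaining triangles are
        triangles of \<open>E\<close>.\<close>
      moreover have "x \<notin> T'" if "T' \<in> P - {T}" for T'
        using that T P unfolding triangle_factor_def partition_on_def disjoint_def by blast
      ultimately have "triangle_factor E (V - {x, y, z}) (P - {T})"
        unfolding T_eq[symmetric] triangle_factor_def E'_def by blast
      moreover have "(x, z) \<in> E" "(y, z) \<in> E"
        using T_edges[of x z] T_edges[of y z] z xy(3) unfolding T_eq E'_def by auto
      moreover have "{x, y, z} \<subseteq> V"
        using P T(1) T_eq unfolding triangle_factor_def partition_on_def by blast
      ultimately show ?thesis
        using xy z by (intro triangle_factor_of_path[of x y z]) auto
    qed
  qed
qed

section \<open>Largest acyclic sets of arcs\<close>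

definition maximal_acyclic :: "('a \<times> 'a) set \<Rightarrow> ('a \<times> 'a) set \<Rightarrow> bool" where
  "maximal_acyclic R A \<longleftrightarrow> A \<subseteq> R \<and> acyclic A \<and> (\<forall>B\<subseteq>R. acyclic B \<longrightarrow> card B \<le> card A)"

lemma ex_maximal_acyclic:
  assumes "finite R"
  obtains A where "maximal_acyclic R A"
proof -
  have "\<exists>A. (A \<subseteq> R \<and> acyclic A) \<and> (\<forall>B. B \<subseteq> R \<and> acyclic B \<longrightarrow> card B \<le> card A)"
    using assms by (intro ex_has_greatest_nat[of _ "{}" _ "Suc (card R)"]) (auto simp: less_Suc_eq_le intro: card_mono acyclicI)
  then show ?thesis
    using that unfolding maximal_acyclic_def by blast
qed

text \<open>Reversal turns the out-degree bound below into the in-degree bound.\<close>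

lemma maximal_acyclic_converse:
  assumes "maximal_acyclic R A"
  shows "maximal_acyclic (R\<inverse>) (A\<inverse>)"
  unfolding maximal_acyclic_def
proof (intro conjI allI impI)
  fix B assume B: "B \<subseteq> R\<inverse>" "acyclic B"
  then have "B\<inverse> \<subseteq> R" "acyclic (B\<inverse>)" by auto
  then show "card B \<le> card (A\<inverse>)"
    using assms unfolding maximal_acyclic_def by (metis card_inverse)
qed (use assms in \<open>auto simp: maximal_acyclic_def\<close>)

text \<open>No arc of the union ends in \<open>x\<close>, so no cycle passes through
  \<open>x\<close>, and a cycle avoiding \<open>x\<close> lies in \<open>A\<close>.\<close>

lemma acyclic_Un_source:
  assumes "acyclic A" and no_in: "\<And>u. (u, x) \<notin> A" and "x \<notin> S"
  shows "acyclic (A \<union> {x} \<times> S)"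
proof (rule acyclicI, rule allI, rule notI)
  fix v assume v: "(v, v) \<in> (A \<union> {x} \<times> S)\<^sup>+"
  have "w \<noteq> x \<and> (u \<noteq> x \<longrightarrow> (u, w) \<in> A\<^sup>+)" if "(u, w) \<in> (A \<union> {x} \<times> S)\<^sup>+" for u w
    using that
  proof (induction rule: trancl_induct)
    case (base w)
    then show ?case using no_in \<open>x \<notin> S\<close> by auto
  next
    case (step w w')
    then show ?case using no_in \<open>x \<notin> S\<close> by (auto intro: trancl_into_trancl)
  qed
  from this[OF v] show False
    using \<open>acyclic A\<close> by (simp add: acyclic_def)
qed

text \<open>The arcs of \<open>A\<close> at \<open>x\<close> are exchanged for all arcs of
  \<open>R\<close> leaving \<open>x\<close>. The new set need not contain \<open>A\<close>, which is
  why \<open>maximal_acyclic\<close> compares cardinalities instead of asking for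
  inclusion-maximality.\<close>

lemma out_degree_le_maximal_acyclic:
  assumes max: "maximal_acyclic R A" and "finite R" and "(x, x) \<notin> R"
  shows "card (R `` {x}) \<le> card ((A \<union> A\<inverse>) `` {x})"
proof -
  have A: "A \<subseteq> R" "acyclic A" "finite A"
    using max \<open>finite R\<close> unfolding maximal_acyclic_def by (auto intro: finite_subset)
  define A0 where "A0 = {(u, v) \<in> A. u \<noteq> x \<and> v \<noteq> x}"
  have "finite A0" "A0 \<subseteq> A"
    using A(3) unfolding A0_def by (auto intro: finite_subset[of _ A])
  have fin: "finite (R `` {x})" "finite (A `` {x})" "finite (A\<inverse> `` {x})"
    using \<open>finite R\<close> A(3) by (auto intro: finite_Image)
  have "acyclic (A0 \<union> {x} \<times> R `` {x})"
    using acyclic_subset[OF A(2) \<open>A0 \<subseteq> A\<close>] \<open>(x, x) \<notin> R\<close>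
    by (intro acyclic_Un_source) (auto simp: A0_def)
  moreover have "A0 \<union> {x} \<times> R `` {x} \<subseteq> R"
    using A(1) \<open>A0 \<subseteq> A\<close> by auto
  ultimately have "card (A0 \<union> {x} \<times> R `` {x}) \<le> card A"
    using max unfolding maximal_acyclic_def by simp
  moreover have "card (A0 \<union> {x} \<times> R `` {x}) = card A0 + card (R `` {x})"
    using fin \<open>finite A0\<close> by (subst card_Un_disjoint) (auto simp: A0_def card_cartesian_product)
  moreover have "card A \<le> card A0 + card ({x} \<times> A `` {x} \<union> A\<inverse> `` {x} \<times> {x})"
    using fin \<open>finite A0\<close>
    by (intro order.trans[OF card_mono card_Un_le]) (auto simp: A0_def)
  moreover have "card ({x} \<times> A `` {x} \<union> A\<inverse> `` {x} \<times> {x}) \<le> card (A `` {x}) + card (A\<inverse> `` {x})"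
    using card_Un_le[of "{x} \<times> A `` {x}" "A\<inverse> `` {x} \<times> {x}"] by (simp add: card_cartesian_product)
  \<comment> \<open>Without 2-cycles, out- and in-neighbours in \<open>A\<close> are disjoint, so
    their numbers add up to the undirected degree.\<close>
  moreover have "card (A `` {x}) + card (A\<inverse> `` {x}) = card ((A \<union> A\<inverse>) `` {x})"
  proof -
    have "A `` {x} \<inter> A\<inverse> `` {x} = {}"
      using A(2) by (auto simp: acyclic_def) (meson r_into_trancl' trancl_into_trancl)
    then show ?thesis
      using fin by (simp add: Un_Image card_Un_disjoint)
  qed
  ultimately show ?thesis by linarith
qed

text \<open>If both arcs were in \<open>R\<close>, adding either to \<open>A\<close> would close a
  cycle; so \<open>A\<close> would contain paths between \<open>x\<close> and \<open>y\<close> in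
  both directions and hence a cycle.\<close>

lemma maximal_acyclic_not_adjacent:
  assumes max: "maximal_acyclic R A" and "finite R"
    and "x \<noteq> y" "(x, y) \<notin> A" "(y, x) \<notin> A"
  shows "(x, y) \<notin> R \<or> (y, x) \<notin> R"
proof (rule ccontr)
  assume R: "\<not> ((x, y) \<notin> R \<or> (y, x) \<notin> R)"
  have A: "A \<subseteq> R" "acyclic A" "finite A"
    using max \<open>finite R\<close> unfolding maximal_acyclic_def by (auto intro: finite_subset)
  have "\<not> acyclic (insert e A)" if "e \<in> R" "e \<notin> A" for e
  proof
    assume "acyclic (insert e A)"
    then have "card (insert e A) \<le> card A"
      using max that A(1) unfolding maximal_acyclic_def by blast
    then show False using that A(3) by simp
  qed
  then have "(x, y) \<in> A\<^sup>*" "(y, x) \<in> A\<^sup>*"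
    using R assms(4,5) A(2) by (metis acyclic_insert)+
  then show False
    using acyclic_impl_antisym_rtrancl[OF A(2)] \<open>x \<noteq> y\<close> by (auto dest: antisymD)
qed

lemma acyclic_triangle:
  assumes "acyclic A" "card T = 3"
    and T: "\<And>x y. \<lbrakk>x \<in> T; y \<in> T; x \<noteq> y\<rbrakk> \<Longrightarrow> (x, y) \<in> A \<union> A\<inverse>"
  obtains a b c where "T = {a, b, c}" "distinct [a, b, c]" "(a, b) \<in> A" "(b, c) \<in> A" "(a, c) \<in> A"
proof -
  obtain p q r where pqr: "T = {p, q, r}" "distinct [p, q, r]"
    using \<open>card T = 3\<close> by (auto simp: card_3_iff)
  have "(p, q) \<in> A \<or> (q, p) \<in> A" "(p, r) \<in> A \<or> (r, p) \<in> A" "(q, r) \<in> A \<or> (r, q) \<in> A"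
    using T pqr by auto
  moreover have no_cycle: "\<not> ((u, v) \<in> A \<and> (v, w) \<in> A \<and> (w, u) \<in> A)" for u v w
    using \<open>acyclic A\<close> unfolding acyclic_def by (meson r_into_trancl' trancl_into_trancl)
  \<comment> \<open>Of the eight orientations of a triangle, \<open>no_cycle\<close> excludes the
    two cyclic ones; the six instances of \<open>that\<close> are the linear orders.\<close>
  ultimately show ?thesis
    using that[of p q r] that[of p r q] that[of q p r] that[of q r p] that[of r p q] that[of r q p]
      no_cycle[of p q r] no_cycle[of p r q] pqr
    by (smt (verit) distinct_length_2_or_more distinct_singleton insert_commute)
qed

section \<open>Reduction of the digraph theorem to the undirected one\<close>

lemma ex_transitive_triples_partition:
  fixes R :: "('a \<times> 'a) set"
  assumes "finite V" "card V = 3 * k" "R \<subseteq> V \<times> V" "irrefl R"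
    and ore: "\<And>x y. \<lbrakk>x \<in> V; y \<in> V; x \<noteq> y; (x, y) \<notin> R\<rbrakk> \<Longrightarrow>
      4 * k \<le> card (R `` {x}) + card (R\<inverse> `` {y}) + 1"
  shows "\<exists>P. partition_on V P \<and> (\<forall>T\<in>P. \<exists>a b c. T = {a, b, c} \<and> distinct [a, b, c] \<and>
    (a, b) \<in> R \<and> (b, c) \<in> R \<and> (a, c) \<in> R)"
proof -
  have "finite R"
    using assms(1,3) by (auto intro: finite_subset)
  then obtain A where max: "maximal_acyclic R A"
    by (rule ex_maximal_acyclic)
  then have A: "A \<subseteq> R" "acyclic A"
    unfolding maximal_acyclic_def by auto
  define E where "E = A \<union> A\<inverse>"
  have out: "card (R `` {x}) \<le> card (E `` {x} \<inter> V)" for x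
  proof -
    have "E `` {x} \<inter> V = E `` {x}"
      using A(1) assms(3) unfolding E_def by auto
    then show ?thesis
      using out_degree_le_maximal_acyclic[OF max \<open>finite R\<close>, of x] assms(4)
      by (simp add: E_def irrefl_def)
  qed
  have "in": "card (R\<inverse> `` {x}) \<le> card (E `` {x} \<inter> V)" for x
  proof -
    have "E `` {x} \<inter> V = E `` {x}"
      using A(1) assms(3) unfolding E_def by auto
    then show ?thesis
      using out_degree_le_maximal_acyclic[OF maximal_acyclic_converse[OF max], of x] assms(4) \<open>finite R\<close>
      by (simp add: E_def irrefl_def Un_commute)
  qed
  \<comment> \<open>One of the two arcs is missing from \<open>R\<close>. It does not matter which,
    as degrees in \<open>E\<close> dominate both out- and in-degrees in \<open>R\<close>.\<close>
  have "4 * k \<le> card (E `` {x} \<inter> V) + card (E `` {y} \<inter> V) + 1"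
    if "x \<in> V" "y \<in> V" "x \<noteq> y" "(x, y) \<notin> E" for x y
    using maximal_acyclic_not_adjacent[OF max \<open>finite R\<close>, of x y] that ore[of x y] ore[of y x]
      out[of x] out[of y] "in"[of x] "in"[of y]
    unfolding E_def by fastforce
  then have "ore_graph E V k"
    using assms(1,2,4) A(1) by unfold_locales (auto simp: E_def sym_def irrefl_def)
  then obtain P where P: "triangle_factor E V P"
    using ore_triangle_factor by blast
  show ?thesis
  proof (intro exI conjI)
    show "partition_on V P"
      using P by (simp add: triangle_factor_def)
    show "\<forall>T\<in>P. \<exists>a b c. T = {a, b, c} \<and> distinct [a, b, c] \<and>
      (a, b) \<in> R \<and> (b, c) \<in> R \<and> (a, c) \<in> R"
    proof
      fix T assume "T \<in> P"
      then have "card T = 3" "\<And>x y. \<lbrakk>x \<in> T; y \<in> T; x \<noteq> y\<rbrakk> \<Longrightarrow> (x, y) \<in> A \<union> A\<inverse>"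
        using P unfolding triangle_factor_def E_def by blast+
      then obtain a b c where "T = {a, b, c}" "distinct [a, b, c]"
        "(a, b) \<in> A" "(b, c) \<in> A" "(a, c) \<in> A"
        by (rule acyclic_triangle[OF A(2)])
      then show "\<exists>a b c. T = {a, b, c} \<and> distinct [a, b, c] \<and> (a, b) \<in> R \<and> (b, c) \<in> R \<and> (a, c) \<in> R"
        using A(1) by blast
    qed
  qed
qed

section \<open>From triples of vertices to subdigraphs\<close>

lemma ex_transitive_tournament_3_copy:
  assumes "wf_digraph G" and dist: "distinct [a, b, c]"
    and arcs: "a \<rightarrow>\<^bsub>G\<^esub> b" "b \<rightarrow>\<^bsub>G\<^esub> c" "a \<rightarrow>\<^bsub>G\<^esub> c"
  shows "\<exists>H. subgraph H G \<and> digraph_iso (transitive_tournament 3) H \<and> verts H = {a, b, c}"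
proof -
  interpret wf_digraph G by fact
  obtain e1 e2 e3 where e: "e1 \<in> arcs G" "tail G e1 = a" "head G e1 = b"
      "e2 \<in> arcs G" "tail G e2 = b" "head G e2 = c" "e3 \<in> arcs G" "tail G e3 = a" "head G e3 = c"
    using arcs unfolding arcs_ends_def arc_to_ends_def by auto
  \<comment> \<open>The last branch serves the arc \<open>(0, 2)\<close>. Taking head and tail from
    \<open>G\<close> makes the image compatible with \<open>G\<close>.\<close>
  define f where "f = \<lparr>iso_verts = (\<lambda>i. [a, b, c] ! i),
    iso_arcs = (\<lambda>ij :: nat \<times> nat. if ij = (0, 1) then e1 else if ij = (1, 2) then e2 else e3),
    iso_head = head G, iso_tail = tail G\<rparr>"
  let ?T = "transitive_tournament 3"
  have T: "verts ?T = {0, 1, 2}" "arcs ?T = {(0, 1), (1, 2), (0, 2)}" "tail ?T = fst" "head ?T = snd"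
    unfolding transitive_tournament_def by auto
  have "wf_digraph ?T"
    using transitive_tournament_properties(1)[of 3]
    by (simp add: digraph_def fin_digraph_def)
  moreover have "inj_on (iso_verts f) (verts ?T)"
    using dist unfolding T f_def by (auto simp: inj_on_def)
  moreover have "inj_on (iso_arcs f) (arcs ?T)"
    using dist e unfolding T f_def by (auto simp: inj_on_def)
  ultimately have iso: "pre_digraph.digraph_isomorphism ?T f"
    unfolding pre_digraph.digraph_isomorphism_def using e unfolding T f_def by auto
  let ?H = "app_iso f ?T"
  have H: "verts ?H = {a, b, c}" "arcs ?H = {e1, e2, e3}" "tail ?H = tail G" "head ?H = head G"
    by (auto simp: T f_def)
  have "wf_digraph ?H"
    by (rule wf_digraph.wf_digraphI_app_iso[OF \<open>wf_digraph ?T\<close> iso])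
  moreover have "{a, b, c} \<subseteq> verts G"
    using e tail_in_verts head_in_verts by blast
  ultimately have "subgraph ?H G"
    using e wf_digraph_axioms unfolding subgraph_def H compatible_def by auto
  moreover have "digraph_iso ?T ?H"
    using iso unfolding digraph_iso_def by blast
  ultimately show ?thesis
    using H(1) by blast
qed

text \<open>Degrees count arcs; without parallel arcs, \<open>head G\<close> is injective on the
  arcs leaving \<open>x\<close>, so this is a count of neighbours.\<close>

lemma (in nomulti_digraph) out_degree_eq_card_successors:
  "out_degree G x = card (arcs_ends G `` {x})"
proof -
  have "arcs_ends G `` {x} = head G ` out_arcs G x"
    by (auto simp: arcs_ends_def arc_to_ends_def)
  moreover have "inj_on (head G) (out_arcs G x)"
    using no_multi_arcs by (auto simp: inj_on_def arc_to_ends_def)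
  ultimately show ?thesis
    by (simp add: out_degree_def card_image)
qed

lemma (in nomulti_digraph) in_degree_eq_card_predecessors:
  "in_degree G x = card ((arcs_ends G)\<inverse> `` {x})"
proof -
  have "(arcs_ends G)\<inverse> `` {x} = tail G ` in_arcs G x"
    by (auto simp: arcs_ends_def arc_to_ends_def)
  moreover have "inj_on (tail G) (in_arcs G x)"
    using no_multi_arcs by (auto simp: inj_on_def arc_to_ends_def)
  ultimately show ?thesis
    by (simp add: in_degree_def card_image)
qed

theorem theorem1p9:
  fixes G :: "('a, 'b) pre_digraph" and n :: nat
  assumes "3 dvd n"
    and "digraph G"
    and "card (verts G) = n"
    and "\<And>x y. \<lbrakk>x \<in> verts G; y \<in> verts G; x \<noteq> y; \<not> (x \<rightarrow>\<^bsub>G\<^esub> y)\<rbrakk> \<Longrightarrow>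
           real (out_degree G x) + real (in_degree G y) \<ge> 4 * real n / 3 - 1"
  shows "\<exists>F. is_factor (transitive_tournament 3) G F"
proof -
  interpret digraph G by fact
  let ?R = "arcs_ends G"
  obtain k where n: "n = 3 * k"
    using \<open>3 dvd n\<close> by blast
  have R: "?R \<subseteq> verts G \<times> verts G" "irrefl ?R"
    using no_loops by (auto simp: arcs_ends_def arc_to_ends_def irrefl_def)
  have ore: "4 * k \<le> card (?R `` {x}) + card (?R\<inverse> `` {y}) + 1"
    if "x \<in> verts G" "y \<in> verts G" "x \<noteq> y" "(x, y) \<notin> ?R" for x y
  proof -
    \<comment> \<open>With n = 3 k the real bound 4 n / 3 - 1 is an integer, so it transfers to
      natural numbers without rounding.\<close>
    have "4 * real k \<le> real (out_degree G x) + real (in_degree G y) + 1"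
      using assms(4)[OF that] n by simp
    then show ?thesis
      unfolding out_degree_eq_card_successors in_degree_eq_card_predecessors by linarith
  qed
  have "\<exists>P. partition_on (verts G) P \<and> (\<forall>T\<in>P. \<exists>a b c. T = {a, b, c} \<and> distinct [a, b, c] \<and>
      a \<rightarrow>\<^bsub>G\<^esub> b \<and> b \<rightarrow>\<^bsub>G\<^esub> c \<and> a \<rightarrow>\<^bsub>G\<^esub> c)"
    by (rule ex_transitive_triples_partition[OF finite_verts assms(3)[unfolded n] R]) (fact ore)
  then obtain P where P: "partition_on (verts G) P \<and> (\<forall>T\<in>P. \<exists>a b c. T = {a, b, c} \<and>
      distinct [a, b, c] \<and> a \<rightarrow>\<^bsub>G\<^esub> b \<and> b \<rightarrow>\<^bsub>G\<^esub> c \<and> a \<rightarrow>\<^bsub>G\<^esub> c)" ..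
  note part = conjunct1[OF P]
  have "\<forall>T\<in>P. \<exists>H. subgraph H G \<and> digraph_iso (transitive_tournament 3) H \<and> verts H = T"
  proof
    fix T assume "T \<in> P"
    then obtain a b c where T: "T = {a, b, c}" and "distinct [a, b, c] \<and>
      a \<rightarrow>\<^bsub>G\<^esub> b \<and> b \<rightarrow>\<^bsub>G\<^esub> c \<and> a \<rightarrow>\<^bsub>G\<^esub> c"
      using conjunct2[OF P] by metis
    then show "\<exists>H. subgraph H G \<and> digraph_iso (transitive_tournament 3) H \<and> verts H = T"
      unfolding T by (intro ex_transitive_tournament_3_copy[OF wf_digraph]) simp_all
  qed
  then obtain H where H: "\<And>T. T \<in> P \<Longrightarrow>
      subgraph (H T) G \<and> digraph_iso (transitive_tournament 3) (H T) \<and> verts (H T) = T"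
    by metis
  have "is_factor (transitive_tournament 3) G (H ` P)"
    unfolding is_factor_def
  proof (intro conjI)
    show "\<forall>K\<in>H ` P. subgraph K G \<and> digraph_iso (transitive_tournament 3) K"
      using H by auto
    show "pairwise (\<lambda>K L. verts K \<inter> verts L = {}) (H ` P)"
      using H partition_onD2[OF part] by (fastforce simp: pairwise_def disjoint_def disjnt_def)
    show "(\<Union>K\<in>H ` P. verts K) = verts G"
      using H partition_onD1[OF part] by simp
  qed
  then show ?thesis by blast
qed

end
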